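(* Let $Y$ be a Poisson random variable with parameter $\alpha>0$. Then for every integer $n\ge 0$ and every real $x$, $$B_{n}^{(L,Y)}(x)=\sum_{k=0}^{n}\phi_{k}(x)\alpha^{k}L(n,k).$$
   Context: Rising factorial: $\langle x\rangle_0=1$, $\langle x\rangle_n=x(x+1)\cdots(x+n-1)$ for $n\ge 1$. Falling factorial: $(x)_0=1$, $(x)_n=x(x-1)\cdots(x-n+1)$ for $n\ge 1$. The unsigned Lah numbers $L(n,k)$ ($n\ge k\ge 0$) are defined by $\langle x\rangle_{n}=\sum_{k=0}^{n}L(n,k)(x)_{k}$. The Bell polynomials are $\phi_{n}(x)=\sum_{k=0}^{n}{n \brace k}x^{k}$, where ${n\brace k}$ are the Stirling numbers of the second kind, given by $x^{n}=\sum_{k=0}^{n}{n\brace k}(x)_{k}$. For a random variable $Y$ whose moment generating function exists in a neighborhood of $0$, the probabilistic Lah numbers $L_Y(n,k)$ ($n\ge k\ge 0$) are defined by the power series expansion about $t=0$ $$\frac{1}{k!}\left(E\left[\left(\frac{1}{1-t}\right)^{Y}\right]-1\right)^{k}=\sum_{n=k}^{\infty}L_{Y}(n,k)\frac{t^{n}}{n!},\quad k\ge 0,$$ and the probabilistic Lah-Bell polynomials associated with $Y$ are $B_{n}^{(L,Y)}(x)=\sum_{k=0}^{n}L_{Y}(n,k)x^{k}$, $n\ge 0$. *)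

theory Defs
  imports "HOL-Probability.Probability" "HOL-Combinatorics.Stirling"
begin

text \<open>
  The rising factorial is the library's \<^const>\<open>pochhammer\<close>.
\<close>

definition falling_fact :: "real \<Rightarrow> nat \<Rightarrow> real" where
  "falling_fact x n = (\<Prod>i<n. x - real i)"

lemma falling_fact_0 [simp]: "falling_fact x 0 = 1"
  by (simp add: falling_fact_def)

lemma falling_fact_Suc: "falling_fact x (Suc n) = falling_fact x n * (x - real n)"
  by (simp add: falling_fact_def)

text \<open>
  The vanishing of the coefficients beyond \<open>n\<close> only fixes the values outside the range
  \<open>k \<le> n\<close>, so that the coefficient sequence is unique.
\<close>

definition Lah :: "nat \<Rightarrow> nat \<Rightarrow> real" where
  "Lah n = (THE c. (\<forall>k>n. c k = 0) \<and>
                   (\<forall>x. pochhammer x n = (\<Sum>k\<le>n. c k * falling_fact x k)))"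

definition bell_poly :: "nat \<Rightarrow> real \<Rightarrow> real" where
  "bell_poly n x = (\<Sum>k\<le>n. real (Stirling n k) * x ^ k)"

text \<open>
  \<open>fact n\<close> times the \<open>n\<close>-th coefficient of the power series about \<open>t = 0\<close> of
  \<open>(E[(1/(1-t)) powr Y] - 1) ^ k / k!\<close>; meaningful when the moment generating function of
  \<open>Y\<close> exists near 0.
\<close>

definition prob_Lah :: "'a measure \<Rightarrow> ('a \<Rightarrow> real) \<Rightarrow> nat \<Rightarrow> nat \<Rightarrow> real" where
  "prob_Lah M Y n k =
     fact n * fps_nth
       (THE F. (\<lambda>t. ((\<integral>\<omega>. (1 / (1 - t)) powr Y \<omega> \<partial>M) - 1) ^ k / fact k) has_fps_expansion F) n"

definition prob_Lah_Bell :: "'a measure \<Rightarrow> ('a \<Rightarrow> real) \<Rightarrow> nat \<Rightarrow> real \<Rightarrow> real" where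
  "prob_Lah_Bell M Y n x = (\<Sum>k\<le>n. prob_Lah M Y n k * x ^ k)"

definition poisson_rv :: "'a measure \<Rightarrow> ('a \<Rightarrow> real) \<Rightarrow> real \<Rightarrow> bool" where
  "poisson_rv M Y \<alpha> \<longleftrightarrow>
     prob_space M \<and> Y \<in> borel_measurable M \<and>
     distr M borel Y = distr (measure_pmf (poisson_pmf \<alpha>)) borel real"


subsection \<open>The notions are well defined\<close>

lemma falling_fact_of_nat_eq_0: "m < k \<Longrightarrow> falling_fact (real m) k = 0"
  by (auto simp: falling_fact_def)

lemma falling_fact_of_nat_neq_0: "falling_fact (real m) m \<noteq> 0"
  by (auto simp: falling_fact_def)

lemma falling_fact_coeffs_unique:
  assumes "\<And>x. (\<Sum>k\<le>n. c k * falling_fact x k) = (\<Sum>k\<le>n. d k * falling_fact x k)"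
    and "m \<le> n"
  shows "c m = d m"
  using assms(2)
proof (induction m rule: less_induct)
  case (less m)
  have split: "(\<Sum>k\<le>n. b k * falling_fact (real m) k) =
      (\<Sum>k<m. b k * falling_fact (real m) k) + b m * falling_fact (real m) m" for b :: "nat \<Rightarrow> real"
  proof -
    have "(\<Sum>k\<le>n. b k * falling_fact (real m) k) = (\<Sum>k\<le>m. b k * falling_fact (real m) k)"
      using less.prems
      by (intro sum.mono_neutral_right) (auto simp: falling_fact_of_nat_eq_0)
    then show ?thesis
      by (simp add: lessThan_Suc_atMost [symmetric])
  qed
  have "(\<Sum>k<m. c k * falling_fact (real m) k) = (\<Sum>k<m. d k * falling_fact (real m) k)"
    using less by (intro sum.cong) auto
  with assms(1)[of "real m"] show ?case
    unfolding split using falling_fact_of_nat_neq_0[of m] by simp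
qed

lemma falling_fact_mult:
  "falling_fact x k * (x + a) = falling_fact x (Suc k) + (a + real k) * falling_fact x k"
  by (simp add: falling_fact_Suc algebra_simps)

lemma falling_fact_expansion_step:
  assumes "\<forall>k>n. c k = 0"
  shows "(\<Sum>k\<le>n. c k * falling_fact x k) * (x + a) =
    (\<Sum>k\<le>Suc n. ((if k = 0 then 0 else c (k - 1)) + (a + real k) * c k) * falling_fact x k)"
proof -
  have "(\<Sum>k\<le>n. c k * falling_fact x k) * (x + a) =
      (\<Sum>k\<le>n. c k * (falling_fact x k * (x + a)))"
    by (simp add: sum_distrib_right mult.assoc)
  also have "\<dots> = (\<Sum>k\<le>n. c k * falling_fact x (Suc k)) +
      (\<Sum>k\<le>n. (a + real k) * c k * falling_fact x k)"
    by (simp add: falling_fact_Suc algebra_simps flip: sum.distrib)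
  also have "(\<Sum>k\<le>n. c k * falling_fact x (Suc k)) =
      (\<Sum>k\<le>Suc n. (if k = 0 then 0 else c (k - 1)) * falling_fact x k)"
    by (subst sum.atMost_Suc_shift) simp
  also have "(\<Sum>k\<le>n. (a + real k) * c k * falling_fact x k) =
      (\<Sum>k\<le>Suc n. (a + real k) * c k * falling_fact x k)"
    using assms by simp
  finally show ?thesis
    by (simp only: sum.distrib [symmetric] distrib_right [symmetric])
qed

lemma power_eq_sum_Stirling:
  "x ^ n = (\<Sum>k\<le>n. real (Stirling n k) * falling_fact x k)"
proof (induction n)
  case (Suc n)
  have "x ^ Suc n = (\<Sum>k\<le>n. real (Stirling n k) * falling_fact x k) * (x + 0)"
    by (simp add: Suc.IH [symmetric])
  also have "\<dots> = (\<Sum>k\<le>Suc n. real (Stirling (Suc n) k) * falling_fact x k)"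
    by (subst falling_fact_expansion_step)
       (auto intro!: sum.cong simp: algebra_simps gr0_conv_Suc)
  finally show ?case .
qed simp

lemma Lah_ex1:
  "\<exists>!c. (\<forall>k>n. c k = 0) \<and> (\<forall>x. pochhammer x n = (\<Sum>k\<le>n. c k * falling_fact x k))"
proof (rule ex_ex1I)
  show "\<exists>c. (\<forall>k>n. c k = 0) \<and> (\<forall>x. pochhammer x n = (\<Sum>k\<le>n. c k * falling_fact x k))"
  proof (induction n)
    case 0
    show ?case by (intro exI[of _ "\<lambda>k. if k = 0 then 1 else 0"]) simp
  next
    case (Suc n)
    then obtain c where c: "\<forall>k>n. c k = 0"
      "\<And>x. pochhammer x n = (\<Sum>k\<le>n. c k * falling_fact x k)" by blast
    let ?d = "\<lambda>k. (if k = 0 then 0 else c (k - 1)) + (real n + real k) * c k"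
    have "pochhammer x (Suc n) = (\<Sum>k\<le>Suc n. ?d k * falling_fact x k)" for x
      unfolding pochhammer_Suc c(2) by (rule falling_fact_expansion_step [OF c(1)])
    moreover have "\<forall>k>Suc n. ?d k = 0"
      using c(1) by auto
    ultimately show ?case
      by (intro exI[of _ ?d]) blast
  qed
next
  fix c d :: "nat \<Rightarrow> real"
  assume c: "(\<forall>k>n. c k = 0) \<and> (\<forall>x. pochhammer x n = (\<Sum>k\<le>n. c k * falling_fact x k))"
    and d: "(\<forall>k>n. d k = 0) \<and> (\<forall>x. pochhammer x n = (\<Sum>k\<le>n. d k * falling_fact x k))"
  show "c = d"
  proof
    fix k show "c k = d k"
    proof (cases "k \<le> n")
      case True
      have "(\<Sum>k\<le>n. c k * falling_fact x k) = (\<Sum>k\<le>n. d k * falling_fact x k)" for x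
        using c d by metis
      then show ?thesis using True by (rule falling_fact_coeffs_unique)
    qed (use c d in auto)
  qed
qed

lemma Lah_eq_0: "n < k \<Longrightarrow> Lah n k = 0"
  and pochhammer_eq_sum_Lah: "pochhammer x n = (\<Sum>k\<le>n. Lah n k * falling_fact x k)"
  using theI' [OF Lah_ex1[of n]] unfolding Lah_def by blast+

lemma has_fps_expansion_unique:
  fixes F G :: "'a :: {banach, real_normed_field} fps"
  assumes "f has_fps_expansion F" "f has_fps_expansion G"
  shows "F = G"
proof -
  define H where "H = F - G"
  let ?n = "subdegree H"
  let ?c = "fps_nth H ?n"
  have "(\<lambda>x. f x - f x) has_fps_expansion H"
    unfolding H_def by (intro has_fps_expansion_diff assms)
  then have "(\<lambda>x. if x = 0 then ?c else (f x - f x) / x ^ ?n) has_fps_expansion fps_shift ?n H"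
    by (rule has_fps_expansion_shift) auto
  then have "isCont (\<lambda>x. if x = 0 then ?c else (f x - f x) / x ^ ?n) 0"
    by (rule has_fps_expansion_imp_continuous)
  then have "((\<lambda>x. if x = 0 then ?c else 0) \<longlongrightarrow> ?c) (at (0::'a))"
    by (simp add: isCont_def cong: if_cong)
  moreover have "((\<lambda>x. if x = 0 then ?c else 0) \<longlongrightarrow> 0) (at (0::'a))"
    by (rule tendsto_eventually) (auto simp: eventually_at_filter)
  ultimately have "?c = 0"
    by (rule tendsto_unique [rotated]) simp
  then have "H = 0"
    by simp
  then show ?thesis
    by (simp add: H_def)
qed

lemma prob_Lah_eqI:
  assumes "(\<lambda>t. ((\<integral>\<omega>. (1 / (1 - t)) powr Y \<omega> \<partial>M) - 1) ^ k / fact k) has_fps_expansion F"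
  shows "prob_Lah M Y n k = fact n * fps_nth F n"
  unfolding prob_Lah_def
  by (subst the_equality [where a = F]) (use assms has_fps_expansion_unique in auto)

end

theory Submission
  imports Defs
begin

text \<open>
  For \<open>Y\<close> Poisson, \<open>E[(1/(1-t)) powr Y] = exp (\<alpha> u)\<close> with \<open>u = t/(1-t)\<close>. Hence the generating
  function of \<open>L\<^sub>Y(\<cdot>, k)\<close> is the composition of \<open>(exp (\<alpha> u) - 1) ^ k / k!\<close>, which generates
  \<open>\<alpha> ^ m S(m, k)\<close>, with \<open>u\<close>, whose divided powers \<open>u ^ m / m!\<close> generate \<open>L(\<cdot>, m)\<close>. Comparing
  coefficients gives \<open>L\<^sub>Y(n, k) = (\<Sum>m\<le>n. S(m, k) \<alpha> ^ m L(n, m))\<close>, and the theorem follows by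
  summing against \<open>x ^ k\<close>.
\<close>

subsection \<open>Composition of power series expansions\<close>

text \<open>Induction on \<open>k\<close>, with the triangle inequality for each Cauchy product. It
  makes the series of norms a majorant for every power of \<open>G\<close> at once.\<close>

lemma norm_fps_power_nth_le:
  fixes G :: "'a :: real_normed_field fps"
  shows "norm (fps_nth (G ^ k) n) \<le> fps_nth (Abs_fps (\<lambda>n. norm (fps_nth G n)) ^ k) n"
proof (induction k arbitrary: n)
  case (Suc k)
  show ?case
    unfolding power_Suc fps_mult_nth
    by (rule order_trans[OF norm_sum sum_mono])
       (auto simp: norm_mult intro!: mult_left_mono Suc.IH)
qed simp

text \<open>Fubini for the double family \<open>h\<close>: summing over \<open>n\<close> first gives
  the value of \<open>F\<close> at \<open>eval_fps G x\<close>, summing over \<open>k\<close> first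
  gives the coefficients of \<open>F oo G\<close>. Absolute summability comes from replacing
  \<open>G\<close> by its series of norms, whose value at \<open>norm x\<close> lies within the
  radius of \<open>F\<close> by \<open>majorant\<close>.\<close>

lemma sums_fps_compose:
  fixes F G :: "'a :: {banach, real_normed_field} fps"
  assumes G0: "fps_nth G 0 = 0"
    and x: "norm x < fps_conv_radius G"
    and majorant: "ereal \<bar>eval_fps (Abs_fps (\<lambda>n. norm (fps_nth G n))) (norm x)\<bar> < fps_conv_radius F"
  shows "(\<lambda>n. fps_nth (F oo G) n * x ^ n) sums eval_fps F (eval_fps G x)"
proof -
  define A where "A = Abs_fps (\<lambda>n. norm (fps_nth G n))"
  define a where "a = eval_fps A (norm x)"
  define h where "h = (\<lambda>(k, n). fps_nth F k * (fps_nth (G ^ k) n * x ^ n))"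
  have xA: "norm (norm x) < fps_conv_radius A"
    using x by (simp add: A_def)
  have A_nonneg: "fps_nth (A ^ k) n \<ge> 0" for k n
    unfolding A_def by (rule order_trans[OF norm_ge_zero norm_fps_power_nth_le])
  have A_sums: "(\<lambda>n. fps_nth (A ^ k) n * norm x ^ n) sums (a ^ k)" for k
    using sums_eval_fps[of "norm x" "A ^ k"] less_le_trans[OF xA fps_conv_radius_power[of A k]]
    by (simp add: a_def eval_fps_power[OF xA])
  have G_sums: "(\<lambda>n. fps_nth (G ^ k) n * x ^ n) sums (eval_fps G x ^ k)" for k
    using sums_eval_fps[of x "G ^ k"] less_le_trans[OF x fps_conv_radius_power[of G k]]
    by (simp add: eval_fps_power[OF x])
  have term_le: "norm (fps_nth (G ^ k) n * x ^ n) \<le> fps_nth (A ^ k) n * norm x ^ n" for k n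
    unfolding A_def norm_mult norm_power
    by (intro mult_right_mono norm_fps_power_nth_le) simp
  have a_nonneg: "a \<ge> 0"
    using A_sums[of 1] A_nonneg[of 1] by (auto simp: sums_iff intro!: suminf_nonneg)
  have G_norm_summable: "summable (\<lambda>n. norm (fps_nth (G ^ k) n * x ^ n))" for k
    by (rule summable_comparison_test'[OF sums_summable[OF A_sums[of k]], of 0])
       (use term_le in auto)
  have G_has_sum: "((\<lambda>n. h (k, n)) has_sum (fps_nth F k * eval_fps G x ^ k)) UNIV" for k
    unfolding h_def prod.case
    by (intro has_sum_cmult_right norm_summable_imp_has_sum G_norm_summable G_sums)

  have "summable (\<lambda>k. norm (fps_nth F k * (of_real a) ^ k))"
    using majorant unfolding fps_conv_radius_def
    by (intro abs_summable_in_conv_radius) (simp add: a_def A_def)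
  then have F_summable: "summable (\<lambda>k. norm (fps_nth F k) * a ^ k)"
    using a_nonneg by (simp add: norm_mult norm_power)
  have "(\<lambda>(k, n). norm (fps_nth F k) * (fps_nth (A ^ k) n * norm x ^ n)) summable_on UNIV \<times> UNIV"
  \<comment> \<open>All terms are nonnegative, so it suffices that the inner sums over
    \<open>n\<close>, which are \<open>norm (fps_nth F k) * a ^ k\<close>, are summable in
    \<open>k\<close>.\<close>
  proof (rule summable_on_SigmaI[where g = "\<lambda>k. norm (fps_nth F k) * a ^ k"])
    show "(\<lambda>k. norm (fps_nth F k) * a ^ k) summable_on UNIV"
      using F_summable a_nonneg by (intro summable_nonneg_imp_summable_on) auto
    show "((\<lambda>n. (case (k, n) of (k, n) \<Rightarrow> norm (fps_nth F k) * (fps_nth (A ^ k) n * norm x ^ n)))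
            has_sum norm (fps_nth F k) * a ^ k) UNIV" for k
      unfolding prod.case using A_nonneg
      by (intro has_sum_cmult_right sums_nonneg_imp_has_sum A_sums) auto
  qed (use A_nonneg in auto)
  then have "(\<lambda>p. norm (h p)) summable_on UNIV \<times> UNIV"
    by (rule summable_on_comparison_test)
       (auto simp: h_def norm_mult[of "fps_nth F _"] intro!: mult_left_mono term_le)
  then have h_summable: "h summable_on UNIV \<times> UNIV"
    by (rule abs_summable_summable)

  then obtain S where S: "(h has_sum S) (UNIV \<times> UNIV)"
    by (auto simp: summable_on_def)
  have "((\<lambda>k. fps_nth F k * eval_fps G x ^ k) has_sum S) UNIV"
    using has_sum_SigmaD[OF S G_has_sum] by simp
  then have "S = eval_fps F (eval_fps G x)"
    unfolding eval_fps_def by (metis has_sum_imp_sums sums_unique)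
  moreover have "((\<lambda>n. fps_nth (F oo G) n * x ^ n) has_sum S) UNIV"
  proof (rule has_sum_SigmaD)
    show "((\<lambda>(n, k). h (k, n)) has_sum S) (UNIV \<times> UNIV)"
      using S by (subst (asm) has_sum_swap)
    \<comment> \<open>Since \<open>G\<close> has zero constant term, \<open>G ^ k\<close> has no
      coefficient at \<open>n\<close> when \<open>k > n\<close>, so the sum over \<open>k\<close> is
      finite.\<close>
    show "((\<lambda>k. (case (n, k) of (n, k) \<Rightarrow> h (k, n))) has_sum fps_nth (F oo G) n * x ^ n) UNIV" for n
      by (rule has_sum_finite_neutralI[of "{0..n}"])
         (auto simp: h_def fps_compose_nth sum_distrib_right mult.assoc
                     startsby_zero_power_prefix[OF G0])
  qed
  ultimately show ?thesis
    by (auto dest: has_sum_imp_sums)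
qed

text \<open>The majorant series \<open>A\<close> is continuous and vanishes at 0, so
  \<open>eval_fps A (norm x)\<close> is below the radius of \<open>F\<close> for all
  \<open>x\<close> near 0, and \<open>sums_fps_compose\<close> applies there.\<close>

lemma has_fps_expansion_compose:
  fixes F G :: "'a :: {banach, real_normed_field} fps"
  assumes f: "f has_fps_expansion F" and g: "g has_fps_expansion G" and G0: "fps_nth G 0 = 0"
  shows "(\<lambda>x. f (g x)) has_fps_expansion (F oo G)"
proof (rule has_fps_expansionI)
  define A where "A = Abs_fps (\<lambda>n. norm (fps_nth G n))"
  have radius: "fps_conv_radius F > 0" "fps_conv_radius G > 0"
    using f g by (auto simp: has_fps_expansion_def)
  have "eval_fps A has_fps_expansion A"
    using radius by (auto simp: has_fps_expansion_def A_def)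
  then have "isCont (eval_fps A) 0"
    by (rule has_fps_expansion_imp_continuous)
  moreover have "((\<lambda>x::'a. norm x) \<longlongrightarrow> 0) (nhds 0)"
    by (auto intro!: tendsto_eq_intros filterlim_ident)
  ultimately have "((\<lambda>x::'a. eval_fps A (norm x)) \<longlongrightarrow> eval_fps A 0) (nhds 0)"
    by (rule isCont_tendsto_compose)
  then have "((\<lambda>x::'a. ereal \<bar>eval_fps A (norm x)\<bar>) \<longlongrightarrow> ereal \<bar>eval_fps A 0\<bar>) (nhds 0)"
    by (intro tendsto_intros)
  then have "((\<lambda>x::'a. ereal \<bar>eval_fps A (norm x)\<bar>) \<longlongrightarrow> 0) (nhds 0)"
    by (simp add: eval_fps_at_0 A_def G0 zero_ereal_def)
  then have "eventually (\<lambda>x::'a. ereal \<bar>eval_fps A (norm x)\<bar> < fps_conv_radius F) (nhds 0)"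
    using radius(1) by (rule order_tendstoD)
  moreover have "eventually (\<lambda>x. x \<in> eball 0 (fps_conv_radius G)) (nhds 0)"
    using radius(2) by (intro eventually_nhds_in_open) (auto simp: zero_ereal_def)
  moreover have "eventually (\<lambda>x. eval_fps G x = g x) (nhds 0)"
    using g by (auto simp: has_fps_expansion_def)
  \<comment> \<open>By continuity \<open>g\<close> maps points near 0 to points near
    \<open>g 0 = 0\<close>, where \<open>F\<close> represents \<open>f\<close>.\<close>
  moreover have "eventually (\<lambda>x. eval_fps F (g x) = f (g x)) (nhds 0)"
  proof -
    have "g 0 = 0"
      using g G0 by (auto simp: has_fps_expansion_def eval_fps_at_0 dest: eventually_nhds_x_imp_x)
    moreover have "isCont g 0"
      using g by (rule has_fps_expansion_imp_continuous)
    ultimately have "filterlim g (nhds 0) (nhds 0)"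
      using tendsto_nhds_iff[of g 0] by (simp add: isCont_def)
    moreover have "eventually (\<lambda>y. eval_fps F y = f y) (nhds 0)"
      using f by (auto simp: has_fps_expansion_def)
    ultimately show ?thesis
      by (rule eventually_compose_filterlim[rotated])
  qed
  ultimately show "eventually (\<lambda>x. (\<lambda>n. fps_nth (F oo G) n * x ^ n) sums f (g x)) (nhds 0)"
  proof eventually_elim
    case (elim x)
    then show ?case
      using sums_fps_compose[OF G0, of x F] by (simp add: A_def)
  qed
qed


subsection \<open>Generating functions of the Stirling and Lah numbers\<close>

text \<open>With \<open>E = fps_exp a - 1\<close> the derivative of \<open>E\<close> is
  \<open>a * (1 + E)\<close>. Comparing coefficients in the derivative of \<open>E ^ Suc j\<close>
  yields the Stirling recurrence.\<close>

lemma fps_exp_minus_one_power_nth: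
  fixes a :: "'a :: field_char_0"
  shows "fps_nth ((fps_exp a - 1) ^ k) n = fact k * a ^ n * of_nat (Stirling n k) / fact n"
proof (induction n arbitrary: k)
  case 0
  show ?case by (cases k) (auto simp: fps_power_zeroth)
next
  case (Suc n)
  show ?case
  proof (cases k)
    case (Suc j)
    let ?E = "fps_exp a - 1 :: 'a fps"
    have "fps_deriv (?E ^ Suc j) = fps_const (of_nat (Suc j) * a) * (?E ^ j + ?E ^ Suc j)"
      unfolding fps_deriv_power by (simp add: algebra_simps)
    then have "of_nat (Suc n) * fps_nth (?E ^ Suc j) (Suc n) =
        of_nat (Suc j) * a * (fps_nth (?E ^ j) n + fps_nth (?E ^ Suc j) n)"
      by (metis fps_deriv_nth Suc_eq_plus1 fps_mult_left_const_nth fps_add_nth)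
    then have "fps_nth (?E ^ Suc j) (Suc n) =
        of_nat (Suc j) * a * (fps_nth (?E ^ j) n + fps_nth (?E ^ Suc j) n) / of_nat (Suc n)"
      by (metis nonzero_mult_div_cancel_left of_nat_Suc of_nat_neq_0)
    then show ?thesis
      unfolding Suc.IH \<open>k = Suc j\<close> by (simp add: field_simps)
  qed simp
qed

lemma Lah_0: "Lah 0 k = (if k = 0 then 1 else 0)"
  using pochhammer_eq_sum_Lah[of 0 0] Lah_eq_0[of 0 k] by auto

text \<open>Multiply the expansion of \<open>pochhammer x n\<close> by \<open>x + real n\<close> and
  compare coefficients.\<close>

lemma Lah_Suc:
  "Lah (Suc n) k = (if k = 0 then 0 else Lah n (k - 1)) + (real n + real k) * Lah n k"
    (is "_ = ?d k")
proof (cases "k \<le> Suc n")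
  case True
  have "(\<Sum>k\<le>Suc n. Lah (Suc n) k * falling_fact x k) = (\<Sum>k\<le>Suc n. ?d k * falling_fact x k)" for x
    unfolding pochhammer_eq_sum_Lah[symmetric] pochhammer_Suc
    unfolding pochhammer_eq_sum_Lah[of x n]
    by (rule falling_fact_expansion_step) (simp add: Lah_eq_0)
  then show ?thesis
    using True by (rule falling_fact_coeffs_unique)
qed (auto simp: Lah_eq_0)

text \<open>The series \<open>u\<close> satisfies \<open>(1 - fps_X) * fps_deriv u = 1 + u\<close>,
  which turns into the recurrence \<open>Lah_Suc\<close> for the coefficients of
  \<open>u ^ k\<close>.\<close>

lemma fps_X_div_one_minus_X_power_nth:
  "fps_nth ((fps_X / (1 - fps_X)) ^ k) n = fact k * Lah n k / fact n"
proof (induction n arbitrary: k)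
  case 0
  show ?case by (cases k) (auto simp: Lah_0 fps_power_zeroth fps_divide_unit)
next
  case (Suc n)
  define u where "u = (fps_X / (1 - fps_X) :: real fps)"
  have u: "(1 - fps_X) * u = fps_X"
    by (simp add: u_def fps_divide_unit inverse_mult_eq_1' flip: mult.assoc)
  have u': "(1 - fps_X) * fps_deriv u = 1 + u"
    using arg_cong[OF u, of fps_deriv] by (simp add: algebra_simps)
  have rec: "real (Suc n) * fps_nth (u ^ k) (Suc n) =
      real k * fps_nth (u ^ (k - 1)) n + (real n + real k) * fps_nth (u ^ k) n"
  proof -
    have "(1 - fps_X) * fps_deriv (u ^ k) = fps_const (real k) * ((1 - fps_X) * fps_deriv u) * u ^ (k - 1)"
      by (simp add: fps_deriv_power mult_ac)
    \<comment> \<open>At \<open>k = 0\<close> the truncated exponent \<open>k - 1\<close> is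
      harmless because the factor \<open>real k\<close> vanishes.\<close>
    also have "\<dots> = fps_const (real k) * (u ^ (k - 1) + u ^ k)"
      unfolding u' by (cases k) (simp_all add: algebra_simps)
    finally have "fps_nth ((1 - fps_X) * fps_deriv (u ^ k)) n =
        real k * (fps_nth (u ^ (k - 1)) n + fps_nth (u ^ k) n)"
      by simp
    \<comment> \<open>The factor \<open>fps_X\<close> shifts the derivative by one place, which
      contributes \<open>real n * fps_nth (u ^ k) n\<close>; this is 0 at
      \<open>n = 0\<close>.\<close>
    moreover have "fps_nth ((1 - fps_X) * fps_deriv (u ^ k)) n =
        real (Suc n) * fps_nth (u ^ k) (Suc n) - real n * fps_nth (u ^ k) n"
      by (cases n) (simp_all add: left_diff_distrib)
    ultimately show ?thesis
      by (simp add: algebra_simps)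
  qed
  then have "fps_nth (u ^ k) (Suc n) =
      (real k * fps_nth (u ^ (k - 1)) n + (real n + real k) * fps_nth (u ^ k) n) / real (Suc n)"
    by (simp add: field_simps)
  \<comment> \<open>Pattern for \<open>k = Suc j\<close>: \<open>p = real k\<close> and
    \<open>f = fact j\<close>, so \<open>p * f = fact k\<close>; \<open>a\<close> and
    \<open>b\<close> are the two Lah numbers of row \<open>n\<close>, \<open>g = fact n\<close> and
    \<open>q = real (Suc n)\<close>.\<close>
  moreover have "(p * (f * a / g) + c * (p * f * b / g)) / q = p * f * (a + c * b) / (q * g)"
    for p f a g c b q :: real
    by (simp add: add_divide_distrib algebra_simps)
  ultimately show ?case
    unfolding u_def Suc.IH Lah_Suc by (cases k) simp_all
qed


subsection \<open>Probabilistic Lah numbers of a Poisson variable\<close>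

text \<open>Weighting \<open>z ^ j\<close> by the Poisson masses gives the exponential series at
  \<open>\<alpha> * z\<close> times \<open>exp (- \<alpha>)\<close>, absolutely convergent for every
  real \<open>z\<close>.\<close>

lemma poisson_pmf_pgf:
  fixes z :: real
  assumes "\<alpha> > 0"
  shows "(\<integral>j. z ^ j \<partial>measure_pmf (poisson_pmf \<alpha>)) = exp (\<alpha> * (z - 1))"
proof -
  have "(\<lambda>j. (\<alpha> * z) ^ j /\<^sub>R fact j * exp (- \<alpha>)) sums (exp (\<alpha> * z) * exp (- \<alpha>))"
    by (intro sums_mult2 exp_converges)
  moreover have "summable (\<lambda>j. norm ((\<alpha> * z) ^ j /\<^sub>R fact j * exp (- \<alpha>)))"
    unfolding norm_mult by (intro summable_mult2 summable_norm_exp)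
  ultimately have "(\<integral>j. (\<alpha> * z) ^ j /\<^sub>R fact j * exp (- \<alpha>) \<partial>count_space UNIV) = exp (\<alpha> * z) * exp (- \<alpha>)"
    by (subst integral_count_space_nat) (simp_all only: integrable_count_space_nat_iff sums_iff)
  then show ?thesis
    using assms
    by (simp add: measure_pmf_eq_density integral_density power_mult_distrib exp_diff exp_minus
                  field_simps)
qed

lemma poisson_rv_expectation_powr:
  assumes "poisson_rv M Y \<alpha>" "\<alpha> > 0" "z > 0"
  shows "(\<integral>\<omega>. z powr Y \<omega> \<partial>M) = exp (\<alpha> * (z - 1))"
proof -
  have "(\<integral>\<omega>. z powr Y \<omega> \<partial>M) = (\<integral>y. z powr y \<partial>distr M borel Y)"
    using assms(1) by (subst integral_distr) (auto simp: poisson_rv_def)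
  also have "\<dots> = (\<integral>j. z powr real j \<partial>measure_pmf (poisson_pmf \<alpha>))"
    using assms(1) by (simp add: poisson_rv_def integral_distr)
  finally show ?thesis
    using assms by (simp add: powr_realpow poisson_pmf_pgf)
qed

lemma prob_Lah_poisson:
  assumes "poisson_rv M Y \<alpha>" "\<alpha> > 0"
  shows "prob_Lah M Y n k = (\<Sum>m\<le>n. real (Stirling m k) * \<alpha> ^ m * Lah n m)"
proof -
  define F where "F = (fps_exp \<alpha> - 1) ^ k * fps_const (1 / fact k)"
  define u where "u = (fps_X / (1 - fps_X) :: real fps)"
  \<comment> \<open>The power is written as a product of \<open>k\<close> equal factors, a shape
    that \<open>fps_expansion_intros\<close> handles.\<close>
  have "(\<lambda>s. (\<Prod>i<k. exp (\<alpha> * s) - 1) * (1 / fact k)) has_fps_expansion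
          (\<Prod>i<k. fps_exp \<alpha> - 1) * fps_const (1 / fact k)"
    by (intro fps_expansion_intros)
  then have "(\<lambda>s. (exp (\<alpha> * s) - 1) ^ k / fact k) has_fps_expansion F"
    by (simp add: F_def)
  moreover have "(\<lambda>t. t / (1 - t)) has_fps_expansion u"
    unfolding u_def by (intro fps_expansion_intros) auto
  ultimately have "(\<lambda>t. (exp (\<alpha> * (t / (1 - t))) - 1) ^ k / fact k) has_fps_expansion (F oo u)"
    by (rule has_fps_expansion_compose) (simp add: u_def fps_divide_unit)
  moreover have "eventually (\<lambda>t. ((\<integral>\<omega>. (1 / (1 - t)) powr Y \<omega> \<partial>M) - 1) ^ k / fact k =
      (exp (\<alpha> * (t / (1 - t))) - 1) ^ k / fact k) (nhds (0::real))"
  proof -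
    \<comment> \<open>For \<open>t < 1\<close> the base \<open>1 / (1 - t)\<close> is positive, as
      \<open>poisson_rv_expectation_powr\<close> demands.\<close>
    have "eventually (\<lambda>t::real. t < 1) (nhds 0)"
      using eventually_nhds_in_open[of "{..<1::real}" 0] by simp
    then show ?thesis
    proof eventually_elim
      case (elim t)
      then have "1 / (1 - t) - 1 = t / (1 - t)"
        by (simp add: field_simps)
      with elim poisson_rv_expectation_powr[OF assms, of "1 / (1 - t)"] show ?case
        by simp
    qed
  qed
  ultimately have "(\<lambda>t. ((\<integral>\<omega>. (1 / (1 - t)) powr Y \<omega> \<partial>M) - 1) ^ k / fact k) has_fps_expansion (F oo u)"
    unfolding has_fps_expansion_def by (auto elim: eventually_elim2)
  then have "prob_Lah M Y n k = fact n * fps_nth (F oo u) n"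
    by (rule prob_Lah_eqI)
  \<comment> \<open>The coefficient of \<open>F\<close> at \<open>m\<close> is
    \<open>\<alpha> ^ m * Stirling m k / fact m\<close>, that of \<open>u ^ m\<close> at
    \<open>n\<close> is \<open>fact m * Lah n m / fact n\<close>; the factorials cancel.\<close>
  also have "\<dots> = (\<Sum>m\<le>n. real (Stirling m k) * \<alpha> ^ m * Lah n m)"
    by (simp add: fps_compose_nth F_def u_def fps_exp_minus_one_power_nth
        fps_X_div_one_minus_X_power_nth sum_distrib_left atMost_atLeast0 mult_ac)
  finally show ?thesis .
qed

theorem theorem2p13:
  fixes M :: "'a measure" and Y :: "'a \<Rightarrow> real" and \<alpha> x :: real and n :: nat
  assumes "\<alpha> > 0"
    and "poisson_rv M Y \<alpha>"
  shows "prob_Lah_Bell M Y n x = (\<Sum>k\<le>n. bell_poly k x * \<alpha> ^ k * Lah n k)"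
proof -
  have "prob_Lah_Bell M Y n x =
      (\<Sum>k\<le>n. \<Sum>m\<le>n. real (Stirling m k) * \<alpha> ^ m * Lah n m * x ^ k)"
    using assms by (simp add: prob_Lah_Bell_def prob_Lah_poisson sum_distrib_right)
  also have "\<dots> = (\<Sum>m\<le>n. (\<Sum>k\<le>n. real (Stirling m k) * x ^ k) * \<alpha> ^ m * Lah n m)"
    by (subst sum.swap) (simp add: sum_distrib_left sum_distrib_right mult_ac)
  also have "\<dots> = (\<Sum>m\<le>n. bell_poly m x * \<alpha> ^ m * Lah n m)"
  proof (rule sum.cong[OF refl])
    fix m assume "m \<in> {..n}"
    \<comment> \<open>The terms with \<open>m < k\<close> vanish, so the range shrinks from
      \<open>n\<close> to \<open>m\<close>.\<close>
    then have "(\<Sum>k\<le>n. real (Stirling m k) * x ^ k) = bell_poly m x"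
      unfolding bell_poly_def by (intro sum.mono_neutral_right) auto
    then show "(\<Sum>k\<le>n. real (Stirling m k) * x ^ k) * \<alpha> ^ m * Lah n m =
        bell_poly m x * \<alpha> ^ m * Lah n m"
      by simp
  qed
  finally show ?thesis .
qed

end
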